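(* Let $X$ be a translation surface and let $\mathcal{R}$ be its set of rigid spines (a subset of the set of saddle connections of $X$). Suppose that the set of holonomy vectors in $\mathbb{R}^2$ of the elements of $\mathcal{R}$ (the rigid spines developed into the plane) is discrete, and that it contains at least two linearly independent vectors. Then the Veech group of $X$ is discrete.
   Context: A saddle connection is a straight-line segment from a singularity to a singularity with no singularity in its interior; its holonomy vector is the vector in $\mathbb{R}^2$ obtained by developing it into the plane. A cylinder is a closed subset of the surface whose interior is foliated by homotopic closed straight-line trajectories and whose boundary consists of saddle connections. A cylinder decomposition is a collection of (possibly infinitely many) cylinders whose closed trajectories have a common direction, meeting pairwise at most along their boundaries, such that the closure of their union is the whole surface. A spine is a line segment in the closure of the union that is not contained in any of the cylinders; a rigid spine is a spine consisting of a single saddle connection. The Veech group of $X$ is the group of derivatives (in $GL_2(\mathbb{R})$) of affine diffeomorphisms of $X$, i.e. diffeomorphisms that are affine in translation charts. *)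

theory Defs
  imports "HOL-Analysis.Analysis"
begin

text \<open>
Model.  A translation surface is given through its metric completion: a type 'a with a
metric (the flat metric), a closed set Sig of singularities (the points of the metric
completion that are not on the surface), the surface itself X = - Sig, and an atlas A of
translation charts (U, phi) on X.  We require that UNIV :: 'a is complete, X is dense
(so UNIV is the metric completion of X), X is connected, the charts are homeomorphisms
onto open subsets of the plane with transition maps that are locally translations, and
the metric on X is the flat metric: the infimum of lengths of polygonal chains made of
straight chart segments.
\<close>

type_synonym 'a chart = "'a set \<times> ('a \<Rightarrow> real^2)"

text \<open>Polygonal chains x = ps!0, ..., ps!n = y together with charts cs!i such that
ps!i and ps!(i+1) lie in the domain of cs!i and the straight segment between their images
lies in the chart image; its flat length is the sum of the Euclidean lengths of these
segments.\<close>

definition flat_chain :: "'a chart set \<Rightarrow> 'a \<Rightarrow> 'a \<Rightarrow> 'a list \<Rightarrow> 'a chart list \<Rightarrow> bool" where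
  "flat_chain A x y ps cs \<longleftrightarrow> ps \<noteq> [] \<and> hd ps = x \<and> last ps = y \<and>
     length cs = length ps - 1 \<and>
     (\<forall>i < length cs. cs ! i \<in> A \<and> ps ! i \<in> fst (cs ! i) \<and> ps ! Suc i \<in> fst (cs ! i) \<and>
        closed_segment (snd (cs ! i) (ps ! i)) (snd (cs ! i) (ps ! Suc i))
          \<subseteq> snd (cs ! i) ` fst (cs ! i))"

definition chain_length :: "'a list \<Rightarrow> 'a chart list \<Rightarrow> real" where
  "chain_length ps cs =
     (\<Sum>i<length cs. norm (snd (cs ! i) (ps ! Suc i) - snd (cs ! i) (ps ! i)))"

definition translation_surface :: "'a::metric_space set \<Rightarrow> 'a chart set \<Rightarrow> bool" where
  "translation_surface Sig A \<longleftrightarrow>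
     complete (UNIV :: 'a set) \<and> closed Sig \<and> closure (- Sig) = UNIV \<and> connected (- Sig) \<and>
     (\<Union>(fst ` A) = - Sig) \<and>
     (\<forall>(U, phi) \<in> A. open U \<and> U \<subseteq> - Sig \<and> inj_on phi U \<and> open (phi ` U) \<and>
        continuous_on U phi \<and> continuous_on (phi ` U) (inv_into U phi)) \<and>
     (\<forall>(U, phi) \<in> A. \<forall>(V, psi) \<in> A. \<forall>p \<in> U \<inter> V.
        \<exists>W c. open W \<and> p \<in> W \<and> W \<subseteq> U \<inter> V \<and> (\<forall>q \<in> W. psi q = phi q + c)) \<and>
     (\<forall>x \<in> - Sig. \<forall>y \<in> - Sig.
        dist x y = Inf {chain_length ps cs | ps cs. flat_chain A x y ps cs})"

text \<open>Saddle connections, parametrised on [0,1] with constant developed velocity v;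
v is the holonomy vector.\<close>

definition saddle_connection ::
  "'a::metric_space set \<Rightarrow> 'a chart set \<Rightarrow> (real \<Rightarrow> 'a) \<Rightarrow> real^2 \<Rightarrow> bool" where
  "saddle_connection Sig A \<gamma> v \<longleftrightarrow>
     v \<noteq> 0 \<and> continuous_on {0..1} \<gamma> \<and> \<gamma> 0 \<in> Sig \<and> \<gamma> 1 \<in> Sig \<and>
     \<gamma> ` {0<..<1} \<subseteq> - Sig \<and>
     (\<forall>t \<in> {0<..<1}. \<forall>(U, phi) \<in> A. \<gamma> t \<in> U \<longrightarrow>
        (\<exists>e>0. \<forall>s. \<bar>s - t\<bar> < e \<longrightarrow>
           \<gamma> s \<in> U \<and> phi (\<gamma> s) = phi (\<gamma> t) + (s - t) *\<^sub>R v))"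

text \<open>A cylinder with core holonomy c: its interior is the injective image (modulo
s ~ s+1) of the open strip R x (0,1) under a map F which in every chart develops as
(s,t) |-> s c + t w + const, with c, w linearly independent; so F(., t) are homotopic
closed straight trajectories with holonomy c.  The cylinder is the closure of its interior
and its boundary is a union of saddle connections.\<close>

definition cylinder ::
  "'a::metric_space set \<Rightarrow> 'a chart set \<Rightarrow> 'a set \<Rightarrow> real^2 \<Rightarrow> bool" where
  "cylinder Sig A C c \<longleftrightarrow>
     closed C \<and> C = closure (interior C) \<and>
     (\<exists>w F. independent {c, w} \<and> c \<noteq> w \<and>
        interior C = {F s t | s t. 0 < t \<and> t < 1} \<and>
        (\<forall>s t. 0 < t \<and> t < 1 \<longrightarrow> F s t \<in> - Sig \<and> F (s + 1) t = F s t) \<and>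
        (\<forall>s t s' t'. 0 < t \<and> t < 1 \<and> 0 < t' \<and> t' < 1 \<and> F s t = F s' t' \<longrightarrow>
            t = t' \<and> s - s' \<in> \<int>) \<and>
        (\<forall>s t. 0 < t \<and> t < 1 \<longrightarrow> (\<forall>(U, phi) \<in> A. F s t \<in> U \<longrightarrow>
            (\<exists>e>0. \<exists>k. \<forall>s' t'. \<bar>s' - s\<bar> < e \<and> \<bar>t' - t\<bar> < e \<longrightarrow>
               F s' t' \<in> U \<and> phi (F s' t') = s' *\<^sub>R c + t' *\<^sub>R w + k)))) \<and>
     frontier C = \<Union>{\<gamma> ` {0..1} | \<gamma> v. saddle_connection Sig A \<gamma> v \<and> \<gamma> ` {0..1} \<subseteq> frontier C}"

text \<open>Cylinder decomposition in direction d.\<close>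

definition cylinder_decomposition ::
  "'a::metric_space set \<Rightarrow> 'a chart set \<Rightarrow> 'a set set \<Rightarrow> real^2 \<Rightarrow> bool" where
  "cylinder_decomposition Sig A \<C> d \<longleftrightarrow>
     d \<noteq> 0 \<and>
     (\<forall>C \<in> \<C>. \<exists>c. cylinder Sig A C c \<and> (\<exists>r::real. c = r *\<^sub>R d)) \<and>
     (\<forall>C \<in> \<C>. \<forall>C' \<in> \<C>. C \<noteq> C' \<longrightarrow> C \<inter> C' \<subseteq> frontier C \<inter> frontier C') \<and>
     closure (\<Union>\<C>) = UNIV"

text \<open>Rigid spine: a saddle connection (parallel to the decomposition direction) lying in the
closure of the union of the cylinders of some cylinder decomposition but not contained in
any of its cylinders.\<close>

definition rigid_spine ::
  "'a::metric_space set \<Rightarrow> 'a chart set \<Rightarrow> (real \<Rightarrow> 'a) \<Rightarrow> real^2 \<Rightarrow> bool" where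
  "rigid_spine Sig A \<gamma> v \<longleftrightarrow>
     saddle_connection Sig A \<gamma> v \<and>
     (\<exists>\<C> d. cylinder_decomposition Sig A \<C> d \<and> (\<exists>r::real. v = r *\<^sub>R d) \<and>
        \<gamma> ` {0..1} \<subseteq> closure (\<Union>\<C>) \<and> (\<forall>C \<in> \<C>. \<not> \<gamma> ` {0..1} \<subseteq> C))"

definition rigid_spine_holonomies :: "'a::metric_space set \<Rightarrow> 'a chart set \<Rightarrow> (real^2) set" where
  "rigid_spine_holonomies Sig A = {v. \<exists>\<gamma>. rigid_spine Sig A \<gamma> v}"

text \<open>Affine diffeomorphisms of X = - Sig with derivative D, and the Veech group.\<close>

definition affine_diffeo ::
  "'a::metric_space set \<Rightarrow> 'a chart set \<Rightarrow> ('a \<Rightarrow> 'a) \<Rightarrow> real^2^2 \<Rightarrow> bool" where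
  "affine_diffeo Sig A f D \<longleftrightarrow>
     bij_betw f (- Sig) (- Sig) \<and> continuous_on (- Sig) f \<and>
     continuous_on (- Sig) (inv_into (- Sig) f) \<and>
     (\<forall>p \<in> - Sig. \<forall>(U, phi) \<in> A. \<forall>(V, psi) \<in> A. p \<in> U \<and> f p \<in> V \<longrightarrow>
        (\<exists>W. open W \<and> p \<in> W \<and> W \<subseteq> U \<and> f ` W \<subseteq> V \<and>
           (\<forall>q \<in> W. psi (f q) = D *v phi q + (psi (f p) - D *v phi p))))"

definition veech_group :: "'a::metric_space set \<Rightarrow> 'a chart set \<Rightarrow> (real^2^2) set" where
  "veech_group Sig A = {D. \<exists>f. affine_diffeo Sig A f D}"

text \<open>Discreteness.  A subset of the plane is discrete if it has no accumulation point;
a subset of GL_2(R) is discrete if each of its points is isolated in it.\<close>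

definition discrete_set :: "'b::metric_space set \<Rightarrow> bool" where
  "discrete_set S \<longleftrightarrow> (\<forall>x. \<not> x islimpt S)"

definition discrete_subset :: "'b::metric_space set \<Rightarrow> bool" where
  "discrete_subset S \<longleftrightarrow> (\<forall>x \<in> S. \<exists>e>0. \<forall>y \<in> S. dist y x < e \<longrightarrow> y = x)"

end

theory Submission
  imports Defs
begin

text \<open>
  An affine diffeomorphism \<open>f\<close> with derivative \<open>D\<close> maps a straight segment inside a chart to a
  polygonal chain whose flat length is \<open>|D v|\<close>, where \<open>v\<close> is the developed vector of the segment.
  Since the flat metric is the infimum of the lengths of such chains, \<open>f\<close> and its inverse are
  Lipschitz, so they extend to mutually inverse homeomorphisms of the metric completion, which
  preserve the singular set. This homeomorphism develops as \<open>D\<close> in charts, hence carries saddle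
  connections, cylinders, cylinder decompositions and rigid spines to objects of the same kind,
  multiplying holonomies by \<open>D\<close>: the Veech group preserves the set \<open>R\<close> of holonomies of rigid
  spines. If \<open>D'\<close> is close to \<open>D\<close>, then \<open>D' u\<close> and \<open>D' v\<close> are close to \<open>D u\<close> and \<open>D v\<close> in the
  discrete set \<open>R\<close>, hence equal to them; as \<open>u\<close> and \<open>v\<close> span the plane, \<open>D' = D\<close>.
\<close>

lemma eventually_nhds_real_iff:
  "eventually P (nhds (t::real)) \<longleftrightarrow> (\<exists>e>0. \<forall>s. \<bar>s - t\<bar> < e \<longrightarrow> P s)"
  unfolding eventually_nhds_metric dist_real_def ..

lemma eventually_nhds_real_pair_iff:
  "eventually P (nhds (s::real, t::real)) \<longleftrightarrow>
     (\<exists>e>0. \<forall>s' t'. \<bar>s' - s\<bar> < e \<and> \<bar>t' - t\<bar> < e \<longrightarrow> P (s', t'))"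
proof
  assume "eventually P (nhds (s, t))"
  then obtain Ps Pt where "eventually Ps (nhds s)" "eventually Pt (nhds t)"
      "\<And>s' t'. Ps s' \<Longrightarrow> Pt t' \<Longrightarrow> P (s', t')"
    unfolding nhds_prod eventually_prod_filter by blast
  moreover from \<open>eventually Ps (nhds s)\<close> obtain e1 where "e1 > 0" "\<And>s'. \<bar>s' - s\<bar> < e1 \<Longrightarrow> Ps s'"
    unfolding eventually_nhds_real_iff by blast
  moreover from \<open>eventually Pt (nhds t)\<close> obtain e2 where "e2 > 0" "\<And>t'. \<bar>t' - t\<bar> < e2 \<Longrightarrow> Pt t'"
    unfolding eventually_nhds_real_iff by blast
  ultimately show "\<exists>e>0. \<forall>s' t'. \<bar>s' - s\<bar> < e \<and> \<bar>t' - t\<bar> < e \<longrightarrow> P (s', t')"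
    by (intro exI[of _ "min e1 e2"]) auto
next
  assume "\<exists>e>0. \<forall>s' t'. \<bar>s' - s\<bar> < e \<and> \<bar>t' - t\<bar> < e \<longrightarrow> P (s', t')"
  then obtain e where "e > 0" and e: "\<And>s' t'. \<bar>s' - s\<bar> < e \<Longrightarrow> \<bar>t' - t\<bar> < e \<Longrightarrow> P (s', t')"
    by blast
  show "eventually P (nhds (s, t))"
    unfolding nhds_prod eventually_prod_filter
  proof (intro exI conjI allI impI)
    show "eventually (\<lambda>s'. \<bar>s' - s\<bar> < e) (nhds s)" "eventually (\<lambda>t'. \<bar>t' - t\<bar> < e) (nhds t)"
      using \<open>e > 0\<close> unfolding eventually_nhds_real_iff by auto
    fix s' t' assume "\<bar>s' - s\<bar> < e" "\<bar>t' - t\<bar> < e"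
    with e show "P (s', t')" by simp
  qed
qed

lemma closed_segment_along_line:
  fixes a b :: "'a::real_vector"
  assumes "s \<le> t"
  shows "closed_segment (a + s *\<^sub>R b) (a + t *\<^sub>R b) = (\<lambda>\<tau>. a + \<tau> *\<^sub>R b) ` {s..t}"
proof -
  have "linear (\<lambda>\<tau>::real. \<tau> *\<^sub>R b)"
    by (rule linear_scaleR_left)
  from closed_segment_linear_image[OF this, of s t]
  have "closed_segment (s *\<^sub>R b) (t *\<^sub>R b) = (\<lambda>\<tau>. \<tau> *\<^sub>R b) ` {s..t}"
    using assms by (simp add: closed_segment_eq_real_ivl)
  then show ?thesis
    by (simp add: closed_segment_translation image_image)
qed

lemma uniform_subdivision_subordinate:
  assumes "{0..1::real} \<subseteq> \<Union>\<U>" "\<And>U. U \<in> \<U> \<Longrightarrow> open U"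
  obtains N :: nat where "N > 0" "\<And>i. i < N \<Longrightarrow> \<exists>U\<in>\<U>. {real i / N..real (Suc i) / N} \<subseteq> U"
proof -
  obtain \<epsilon> where \<epsilon>: "\<epsilon> > 0" "\<And>x. x \<in> {0..1} \<Longrightarrow> \<exists>U\<in>\<U>. ball x \<epsilon> \<subseteq> U"
    using Heine_Borel_lemma[OF compact_Icc assms] by blast
  obtain N :: nat where "1 / \<epsilon> < N"
    using reals_Archimedean2 by blast
  moreover have "0 < 1 / \<epsilon>" using \<epsilon>(1) by simp
  ultimately have "0 < real N" by linarith
  with \<open>1 / \<epsilon> < N\<close> \<epsilon>(1) have N: "N > 0" "1 / real N < \<epsilon>"
    by (auto simp: divide_less_eq mult.commute)
  have "\<exists>U\<in>\<U>. {real i / N..real (Suc i) / N} \<subseteq> U" if "i < N" for i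
  proof -
    from that have "real i / N \<in> {0..1}" by simp
    then obtain U where "U \<in> \<U>" "ball (real i / N) \<epsilon> \<subseteq> U"
      using \<epsilon>(2) by blast
    moreover have "{real i / N..real (Suc i) / N} \<subseteq> ball (real i / N) \<epsilon>"
    proof
      fix \<tau> assume "\<tau> \<in> {real i / N..real (Suc i) / N}"
      moreover have "real (Suc i) / N = real i / N + 1 / N"
        by (simp add: add_divide_distrib)
      ultimately show "\<tau> \<in> ball (real i / N) \<epsilon>"
        using N(2) by (simp add: dist_real_def)
    qed
    ultimately show ?thesis by blast
  qed
  with N(1) that show ?thesis by blast
qed

lemma lipschitz_extension_to_completion:
  fixes f :: "'a::metric_space \<Rightarrow> 'a"
  assumes "complete (UNIV :: 'a set)" "closure X = UNIV" "K-lipschitz_on X f"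
  obtains g where "continuous_on UNIV g" "\<And>x. x \<in> X \<Longrightarrow> g x = f x"
proof -
  have "Cauchy_continuous_on X f"
    using assms(3) by (intro uniformly_continuous_imp_Cauchy_continuous lipschitz_on_uniformly_continuous)
  then have "Cauchy_continuous_map (submetric euclidean_metric X) euclidean_metric f"
    by (simp only: Cauchy_continuous_map_euclidean)
  moreover have "mcomplete_of (euclidean_metric :: 'a metric)"
    using assms(1) unfolding mcomplete_of_def euclidean_metric_def by simp
  ultimately obtain g
    where "continuous_map (subtopology euclidean (euclidean closure_of X)) euclidean g"
      "\<And>x. x \<in> X \<Longrightarrow> g x = f x"
    by (metis Cauchy_continuous_map_extends_to_continuous_closure_of mtopology_of_euclidean)
  with assms(2) that show ?thesis
    by (simp only: euclidean_closure_of continuous_map_iff_continuous)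
qed

lemma continuous_eq_on_dense:
  fixes p q :: "'a::topological_space \<Rightarrow> 'b::metric_space"
  assumes "closure X = UNIV" "continuous_on UNIV p" "continuous_on UNIV q"
    and "\<And>x. x \<in> X \<Longrightarrow> p x = q x"
  shows "p x = q x"
proof -
  have "continuous_on (closure X) (\<lambda>x. dist (p x) (q x))"
    unfolding assms(1) using assms(2,3) by (rule continuous_on_dist)
  moreover have "dist (p x) (q x) = 0" if "x \<in> X" for x
    using assms(4)[OF that] by simp
  moreover have "x \<in> closure X"
    using assms(1) by simp
  ultimately have "dist (p x) (q x) = 0"
    by (rule continuous_constant_on_closure)
  then show ?thesis by simp
qed

lemma Inf_le_mult_Inf:
  fixes S T :: "real set"
  assumes "S \<noteq> {}" "bdd_below T" "K > 0" "\<And>l. l \<in> S \<Longrightarrow> \<exists>t\<in>T. t \<le> K * l"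
  shows "Inf T \<le> K * Inf S"
proof -
  have "Inf T / K \<le> l" if l: "l \<in> S" for l
  proof -
    obtain t where "t \<in> T" "t \<le> K * l" using assms(4)[OF l] by blast
    then have "Inf T \<le> K * l" using assms(2) by (meson cInf_lower order_trans)
    then show ?thesis using assms(3) by (simp add: divide_le_eq mult.commute)
  qed
  then have "Inf T / K \<le> Inf S" using assms(1) by (intro cInf_greatest) auto
  then show ?thesis using assms(3) by (simp add: divide_le_eq mult.commute)
qed

section \<open>Flat chains\<close>

lemma flat_chain_Nil: "flat_chain A x y ps [] \<longleftrightarrow> ps = [x] \<and> x = y"
  unfolding flat_chain_def by (cases ps) auto

lemma flat_chain_Cons:
  "flat_chain A x y ps (c # cs) \<longleftrightarrow>
     (\<exists>p ps'. ps = x # p # ps' \<and> c \<in> A \<and> x \<in> fst c \<and> p \<in> fst c \<and>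
        closed_segment (snd c x) (snd c p) \<subseteq> snd c ` fst c \<and> flat_chain A p y (p # ps') cs)"
proof -
  have split: "flat_chain A x' y (x' # p # ps') (c # cs) \<longleftrightarrow> c \<in> A \<and> x' \<in> fst c \<and> p \<in> fst c \<and>
        closed_segment (snd c x') (snd c p) \<subseteq> snd c ` fst c \<and> flat_chain A p y (p # ps') cs"
    for x' p ps'
    unfolding flat_chain_def by (simp add: All_less_Suc2 last_ConsR del: last.simps) blast
  have "\<exists>p ps'. ps = x # p # ps'" if "flat_chain A x y ps (c # cs)"
    using that unfolding flat_chain_def by (cases ps; cases "tl ps") auto
  then show ?thesis
    using split by blast
qed

lemma chain_length_Cons:
  "chain_length (x # p # ps) (c # cs) = norm (snd c p - snd c x) + chain_length (p # ps) cs"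
  unfolding chain_length_def length_Cons sum.lessThan_Suc_shift by simp

lemma chain_length_nonneg: "chain_length ps cs \<ge> 0"
  unfolding chain_length_def by (simp add: sum_nonneg)

lemma flat_chain_append:
  assumes "flat_chain A x y ps cs" "flat_chain A y z qs ds"
  shows "flat_chain A x z (ps @ tl qs) (cs @ ds) \<and>
         chain_length (ps @ tl qs) (cs @ ds) = chain_length ps cs + chain_length qs ds"
  using assms
proof (induction cs arbitrary: x ps)
  case Nil
  then have "ps = [x]" "x = y" by (auto simp: flat_chain_Nil)
  moreover have "qs = y # tl qs" using Nil(2) unfolding flat_chain_def by (cases qs) auto
  ultimately show ?case using Nil(2) by (simp add: chain_length_def)
next
  case (Cons c cs)
  from Cons.prems(1) obtain p ps' where ps: "ps = x # p # ps'"
    and c: "c \<in> A" "x \<in> fst c" "p \<in> fst c" "closed_segment (snd c x) (snd c p) \<subseteq> snd c ` fst c"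
    and tail: "flat_chain A p y (p # ps') cs"
    unfolding flat_chain_Cons by blast
  from Cons.IH[OF tail Cons.prems(2)] c show ?case
    unfolding ps by (simp add: flat_chain_Cons chain_length_Cons)
qed

lemma flat_chain_along_line:
  fixes \<rho> :: "real \<Rightarrow> 'a" and ch :: "nat \<Rightarrow> 'a chart"
  assumes "N > 0" and "\<And>i. i < N \<Longrightarrow> ch i \<in> A"
    and "\<And>i \<tau>. i < N \<Longrightarrow> \<tau> \<in> {real i / N..real (Suc i) / N} \<Longrightarrow>
           \<rho> \<tau> \<in> fst (ch i) \<and> snd (ch i) (\<rho> \<tau>) = a i + \<tau> *\<^sub>R b"
  shows "\<exists>ps cs. flat_chain A (\<rho> 0) (\<rho> 1) ps cs \<and> chain_length ps cs = norm b"
proof -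
  define ps where "ps = map (\<lambda>i. \<rho> (real i / N)) [0..<Suc N]"
  define cs where "cs = map ch [0..<N]"
  have ps_nth: "ps ! i = \<rho> (real i / N)" if "i \<le> N" for i
    unfolding ps_def using that by (simp del: upt_Suc add: nth_map_upt)
  have endpoints: "ps ! i \<in> fst (cs ! i) \<and> snd (cs ! i) (ps ! i) = a i + (real i / N) *\<^sub>R b"
      "ps ! Suc i \<in> fst (cs ! i) \<and> snd (cs ! i) (ps ! Suc i) = a i + (real (Suc i) / N) *\<^sub>R b"
    if "i < N" for i
    using that assms(3)[OF that] ps_nth[of i] ps_nth[of "Suc i"]
    by (auto simp: cs_def divide_right_mono)
  have segment: "closed_segment (snd (cs ! i) (ps ! i)) (snd (cs ! i) (ps ! Suc i))
      \<subseteq> snd (cs ! i) ` fst (cs ! i)" if "i < N" for i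
  proof -
    have "closed_segment (snd (cs ! i) (ps ! i)) (snd (cs ! i) (ps ! Suc i))
        = (\<lambda>\<tau>. a i + \<tau> *\<^sub>R b) ` {real i / N..real (Suc i) / N}"
      using endpoints[OF that] by (simp add: closed_segment_along_line divide_right_mono)
    also have "\<dots> \<subseteq> snd (ch i) ` fst (ch i)"
      using assms(3)[OF that] by (force simp del: of_nat_Suc)
    finally show ?thesis using that by (simp add: cs_def)
  qed
  have "flat_chain A (\<rho> 0) (\<rho> 1) ps cs"
    unfolding flat_chain_def
    using assms(1,2) endpoints segment ps_nth[of 0] ps_nth[of N]
    by (auto simp: cs_def ps_def hd_conv_nth last_conv_nth simp del: upt_Suc)
  moreover have "chain_length ps cs = (\<Sum>i<N. norm ((1 / real N) *\<^sub>R b))"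
    unfolding chain_length_def
  proof (rule sum.cong)
    fix i assume "i \<in> {..<N}"
    then have "snd (cs ! i) (ps ! Suc i) - snd (cs ! i) (ps ! i) = (1 / real N) *\<^sub>R b"
      using endpoints[of i] by (simp add: diff_divide_distrib[symmetric] scaleR_diff_left[symmetric])
    then show "norm (snd (cs ! i) (ps ! Suc i) - snd (cs ! i) (ps ! i)) = norm ((1 / real N) *\<^sub>R b)"
      by simp
  qed (simp add: cs_def)
  moreover have "(\<Sum>i<N. norm ((1 / real N) *\<^sub>R b)) = norm b"
    using assms(1) by simp
  ultimately show ?thesis by auto
qed

lemma flat_chain_along_locally_straight_path:
  fixes \<rho> :: "real \<Rightarrow> 'a"
  assumes "\<And>\<tau>. \<tau> \<in> {0..1} \<Longrightarrow> \<exists>B V psi c. open B \<and> \<tau> \<in> B \<and> (V, psi) \<in> A \<and>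
      (\<forall>\<tau>' \<in> B \<inter> {0..1}. \<rho> \<tau>' \<in> V \<and> psi (\<rho> \<tau>') = c + \<tau>' *\<^sub>R b)"
  shows "\<exists>ps cs. flat_chain A (\<rho> 0) (\<rho> 1) ps cs \<and> chain_length ps cs = norm b"
proof -
  define \<U> where "\<U> = {B. open B \<and> (\<exists>V psi c. (V, psi) \<in> A \<and>
      (\<forall>\<tau> \<in> B \<inter> {0..1}. \<rho> \<tau> \<in> V \<and> psi (\<rho> \<tau>) = c + \<tau> *\<^sub>R b))}"
  have "{0..1} \<subseteq> \<Union>\<U>"
  proof
    fix \<tau> :: real assume "\<tau> \<in> {0..1}"
    from assms[OF this] obtain B V psi c where "open B" "\<tau> \<in> B" "(V, psi) \<in> A"
        "\<forall>\<tau>' \<in> B \<inter> {0..1}. \<rho> \<tau>' \<in> V \<and> psi (\<rho> \<tau>') = c + \<tau>' *\<^sub>R b"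
      by blast
    then have "B \<in> \<U>" unfolding \<U>_def by blast
    with \<open>\<tau> \<in> B\<close> show "\<tau> \<in> \<Union>\<U>" by blast
  qed
  moreover have "open B" if "B \<in> \<U>" for B
    using that unfolding \<U>_def by blast
  ultimately obtain N where N: "N > 0" "\<And>i. i < N \<Longrightarrow> \<exists>B\<in>\<U>. {real i / N..real (Suc i) / N} \<subseteq> B"
    using uniform_subdivision_subordinate[of \<U>] by blast
  have "\<forall>i. i < N \<longrightarrow> (\<exists>chc. fst chc \<in> A \<and> (\<forall>\<tau> \<in> {real i / N..real (Suc i) / N}.
      \<rho> \<tau> \<in> fst (fst chc) \<and> snd (fst chc) (\<rho> \<tau>) = snd chc + \<tau> *\<^sub>R b))"
  proof (intro allI impI)
    fix i assume i: "i < N"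
    obtain B where "B \<in> \<U>" and sub: "{real i / N..real (Suc i) / N} \<subseteq> B"
      using N(2)[OF i] by blast
    then obtain V psi c where "(V, psi) \<in> A"
        and on_B: "\<forall>\<tau> \<in> B \<inter> {0..1}. \<rho> \<tau> \<in> V \<and> psi (\<rho> \<tau>) = c + \<tau> *\<^sub>R b"
      unfolding \<U>_def by blast
    moreover have "{real i / N..real (Suc i) / N} \<subseteq> B \<inter> {0..1}" using sub i by auto
    with on_B have "\<forall>\<tau> \<in> {real i / N..real (Suc i) / N}. \<rho> \<tau> \<in> V \<and> psi (\<rho> \<tau>) = c + \<tau> *\<^sub>R b"
      by blast
    ultimately show "\<exists>chc. fst chc \<in> A \<and> (\<forall>\<tau> \<in> {real i / N..real (Suc i) / N}.
        \<rho> \<tau> \<in> fst (fst chc) \<and> snd (fst chc) (\<rho> \<tau>) = snd chc + \<tau> *\<^sub>R b)"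
      by (intro exI[of _ "((V, psi), c)"]) simp
  qed
  then obtain k where k: "\<forall>i. i < N \<longrightarrow> fst (k i) \<in> A \<and> (\<forall>\<tau> \<in> {real i / N..real (Suc i) / N}.
      \<rho> \<tau> \<in> fst (fst (k i)) \<and> snd (fst (k i)) (\<rho> \<tau>) = snd (k i) + \<tau> *\<^sub>R b)"
    unfolding choice_iff' by blast
  have chart_k: "\<And>i. i < N \<Longrightarrow> fst (k i) \<in> A"
    and straight_k: "\<And>i \<tau>. i < N \<Longrightarrow> \<tau> \<in> {real i / N..real (Suc i) / N} \<Longrightarrow>
      \<rho> \<tau> \<in> fst (fst (k i)) \<and> snd (fst (k i)) (\<rho> \<tau>) = snd (k i) + \<tau> *\<^sub>R b"
    using k by blast+
  show ?thesis
    by (rule flat_chain_along_line[where \<rho> = \<rho> and ch = "\<lambda>i. fst (k i)" and a = "\<lambda>i. snd (k i)"])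
      (fact N(1) chart_k straight_k)+
qed

section \<open>Affine diffeomorphisms are Lipschitz\<close>

locale trans_surface =
  fixes Sig :: "'a::metric_space set" and A :: "'a chart set"
  assumes translation_surface: "translation_surface Sig A"
begin

lemma open_surface: "open (- Sig)"
  using translation_surface unfolding translation_surface_def by auto

lemma complete_UNIV: "complete (UNIV :: 'a set)"
  using translation_surface unfolding translation_surface_def by auto

lemma dense_surface: "closure (- Sig) = UNIV"
  using translation_surface unfolding translation_surface_def by auto

lemma chartD:
  assumes "(U, phi) \<in> A"
  shows "open U" "U \<subseteq> - Sig" "inj_on phi U" "open (phi ` U)"
    "continuous_on (phi ` U) (inv_into U phi)"
proof -
  have "\<forall>(U, phi) \<in> A. open U \<and> U \<subseteq> - Sig \<and> inj_on phi U \<and> open (phi ` U) \<and>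
      continuous_on U phi \<and> continuous_on (phi ` U) (inv_into U phi)"
    using translation_surface unfolding translation_surface_def by (elim conjE) assumption
  from bspec[OF this assms] show "open U" "U \<subseteq> - Sig" "inj_on phi U" "open (phi ` U)"
    "continuous_on (phi ` U) (inv_into U phi)"
    by simp_all
qed

lemma chart_cover:
  assumes "x \<in> - Sig"
  obtains U phi where "(U, phi) \<in> A" "x \<in> U"
proof -
  have "\<Union>(fst ` A) = - Sig"
    using translation_surface unfolding translation_surface_def by auto
  with assms obtain c where "c \<in> A" "x \<in> fst c" by blast
  with that show ?thesis by (cases c) auto
qed

lemma dist_flat:
  assumes "x \<in> - Sig" "y \<in> - Sig"
  shows "dist x y = Inf {chain_length ps cs | ps cs. flat_chain A x y ps cs}"
  using translation_surface assms unfolding translation_surface_def by auto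

lemma chart_image_open:
  assumes U: "(U, phi) \<in> A" and "open W" "W \<subseteq> U"
  shows "open (phi ` W)"
proof -
  have "phi ` W = inv_into U phi -` W \<inter> phi ` U"
    using assms(3) chartD(3)[OF U] by (auto simp: inv_into_f_f subsetD)
  moreover have "open (inv_into U phi -` W \<inter> phi ` U)"
    using chartD(4,5)[OF U] \<open>open W\<close> continuous_on_open_vimage by blast
  ultimately show ?thesis by simp
qed

end

locale affine_diffeomorphism = trans_surface +
  fixes f :: "'a::metric_space \<Rightarrow> 'a" and D :: "real^2^2"
  assumes affine_diffeo: "affine_diffeo Sig A f D"
begin

abbreviation finv :: "'a \<Rightarrow> 'a" where "finv \<equiv> inv_into (- Sig) f"

lemma bij_surface: "bij_betw f (- Sig) (- Sig)"
  using affine_diffeo unfolding affine_diffeo_def by auto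

lemma continuous_on_finv: "continuous_on (- Sig) finv"
  using affine_diffeo unfolding affine_diffeo_def by auto

lemma maps_surface: "x \<in> - Sig \<Longrightarrow> f x \<in> - Sig"
  using bij_surface bij_betwE by blast

lemma finv_maps_surface: "y \<in> - Sig \<Longrightarrow> finv y \<in> - Sig"
  using bij_surface by (meson bij_betwE bij_betw_inv_into)

lemma f_finv: "y \<in> - Sig \<Longrightarrow> f (finv y) = y"
  using bij_surface by (simp add: bij_betw_def f_inv_into_f)

lemma finv_f: "x \<in> - Sig \<Longrightarrow> finv (f x) = x"
  using bij_surface by (simp add: bij_betw_def inv_into_f_f)

lemma affine_in_charts:
  assumes "p \<in> - Sig" "(U, phi) \<in> A" "(V, psi) \<in> A" "p \<in> U" "f p \<in> V"
  obtains W where "open W" "p \<in> W" "W \<subseteq> U" "f ` W \<subseteq> V"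
    "\<And>q. q \<in> W \<Longrightarrow> psi (f q) = D *v phi q + (psi (f p) - D *v phi p)"
proof -
  have affine_locally: "\<forall>p \<in> - Sig. \<forall>(U, phi) \<in> A. \<forall>(V, psi) \<in> A. p \<in> U \<and> f p \<in> V \<longrightarrow>
        (\<exists>W. open W \<and> p \<in> W \<and> W \<subseteq> U \<and> f ` W \<subseteq> V \<and>
           (\<forall>q \<in> W. psi (f q) = D *v phi q + (psi (f p) - D *v phi p)))"
    using affine_diffeo unfolding affine_diffeo_def by (elim conjE) assumption
  have "\<forall>(V, psi) \<in> A. p \<in> U \<and> f p \<in> V \<longrightarrow>
        (\<exists>W. open W \<and> p \<in> W \<and> W \<subseteq> U \<and> f ` W \<subseteq> V \<and>
           (\<forall>q \<in> W. psi (f q) = D *v phi q + (psi (f p) - D *v phi p)))"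
    using bspec[OF bspec[OF affine_locally assms(1)] assms(2)] by simp
  from bspec[OF this assms(3)] assms(4,5) that show ?thesis by auto
qed

lemma eventually_image_developed:
  assumes U0: "(U0, phi0) \<in> A" and U: "(U, phi) \<in> A" and p: "p \<in> U0" "f p \<in> U"
    and develops: "\<forall>\<^sub>F s in F. \<Phi> s \<in> U0 \<and> phi0 (\<Phi> s) = L s"
    and lim: "(L \<longlongrightarrow> phi0 p) F"
  shows "\<forall>\<^sub>F s in F. \<Phi> s \<in> - Sig \<and> f (\<Phi> s) \<in> U \<and>
           phi (f (\<Phi> s)) = D *v L s + (phi (f p) - D *v phi0 p)"
proof -
  have "p \<in> - Sig" using p(1) chartD(2)[OF U0] by blast
  then obtain W where W: "open W" "p \<in> W" "W \<subseteq> U0" "f ` W \<subseteq> U"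
      "\<And>q. q \<in> W \<Longrightarrow> phi (f q) = D *v phi0 q + (phi (f p) - D *v phi0 p)"
    using affine_in_charts[OF _ U0 U p] by blast
  have "\<forall>\<^sub>F s in F. L s \<in> phi0 ` W"
    using lim chart_image_open[OF U0 W(1,3)] W(2) by (auto intro: topological_tendstoD)
  with develops show ?thesis
  proof eventually_elim
    case (elim s)
    then obtain q where q: "q \<in> W" "phi0 q = L s" by auto
    moreover have "q \<in> U0" using q(1) W(3) by blast
    ultimately have "\<Phi> s = q" using elim chartD(3)[OF U0] by (metis inj_on_def)
    with q W(3-5) chartD(2)[OF U0] show ?case by auto
  qed
qed

lemma derivative_injective:
  assumes "D *v z = 0" shows "z = 0"
proof (rule ccontr)
  assume z: "z \<noteq> 0"
  have "- Sig \<noteq> {}" using dense_surface by (metis closure_empty UNIV_not_empty)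
  then obtain p where p: "p \<in> - Sig" by blast
  obtain U phi where U: "(U, phi) \<in> A" "p \<in> U" using chart_cover[OF p] by blast
  obtain V psi where V: "(V, psi) \<in> A" "f p \<in> V" using chart_cover[OF maps_surface[OF p]] by blast
  obtain W where W: "open W" "p \<in> W" "W \<subseteq> U" "f ` W \<subseteq> V"
    "\<And>q. q \<in> W \<Longrightarrow> psi (f q) = D *v phi q + (psi (f p) - D *v phi p)"
    using affine_in_charts[OF p U(1) V(1) U(2) V(2)] by blast
  obtain r where r: "r > 0" "ball (phi p) r \<subseteq> phi ` W"
    using chart_image_open[OF U(1) W(1,3)] W(2) open_contains_ball by blast
  define x where "x = phi p + (r / (2 * norm z)) *\<^sub>R z"
  have "dist (phi p) x = r / 2" using z r unfolding x_def by (simp add: dist_norm)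
  then have "x \<noteq> phi p" "x \<in> ball (phi p) r" using r(1) by auto
  then obtain q where q: "q \<in> W" "phi q = x" using r(2) by blast
  with \<open>x \<noteq> phi p\<close> have "q \<noteq> p" by blast
  have "D *v x = D *v phi p"
    unfolding x_def by (simp add: matrix_vector_right_distrib matrix_vector_mult_scaleR assms)
  then have "psi (f q) = psi (f p)" using W(5)[OF q(1)] q(2) by simp
  with W(4) q(1) V chartD(3)[OF V(1)] have "f q = f p" by (auto dest: inj_onD)
  moreover have "q \<in> - Sig" using q(1) W(3) chartD(2)[OF U(1)] by auto
  ultimately have "q = p"
    using inj_onD[OF bij_betw_imp_inj_on[OF bij_surface]] p by blast
  with \<open>q \<noteq> p\<close> show False by contradiction
qed

lemma inj_derivative: "inj ((*v) D)"
proof (rule injI)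
  fix x y assume "D *v x = D *v y"
  then have "D *v (x - y) = 0" by (simp add: matrix_vector_mult_diff_distrib)
  then have "x - y = 0" by (rule derivative_injective)
  then show "x = y" by simp
qed

lemma derivative_left_invertible: "\<exists>Di. Di ** D = mat 1"
  unfolding matrix_left_invertible_ker using derivative_injective by blast

lemma finv_affine_in_charts:
  assumes Di: "Di ** D = mat 1"
    and y: "y \<in> - Sig" and U: "(U, phi) \<in> A" and V: "(V, psi) \<in> A"
    and "y \<in> U" "finv y \<in> V"
  shows "\<exists>W. open W \<and> y \<in> W \<and> W \<subseteq> U \<and> finv ` W \<subseteq> V \<and>
    (\<forall>y' \<in> W. psi (finv y') = Di *v phi y' + (psi (finv y) - Di *v phi y))"
proof -
  define x where "x = finv y"
  have x: "x \<in> - Sig" "f x = y" using finv_maps_surface[OF y] f_finv[OF y] by (auto simp: x_def)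
  obtain W where W: "open W" "x \<in> W" "W \<subseteq> V" "f ` W \<subseteq> U"
    "\<And>x'. x' \<in> W \<Longrightarrow> phi (f x') = D *v psi x' + (phi (f x) - D *v psi x)"
    using affine_in_charts[OF x(1) V U] \<open>y \<in> U\<close> \<open>finv y \<in> V\<close> x by (metis x_def)
  define W' where "W' = finv -` W \<inter> - Sig"
  have "open W'"
    unfolding W'_def using continuous_on_open_vimage[OF open_surface] continuous_on_finv W(1)
    by blast
  moreover have "y \<in> W'" using W(2) y unfolding W'_def x_def by blast
  moreover have "W' \<subseteq> U" using W(4) f_finv unfolding W'_def by force
  moreover have "finv ` W' \<subseteq> V" using W(3) unfolding W'_def by blast
  moreover have "psi (finv y') = Di *v phi y' + (psi (finv y) - Di *v phi y)" if "y' \<in> W'" for y'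
  proof -
    from that have "finv y' \<in> W" "y' \<in> - Sig" unfolding W'_def by auto
    then have "phi y' = D *v psi (finv y') + (phi y - D *v psi x)"
      using W(5) f_finv x(2) by metis
    then have "Di *v phi y' = psi (finv y') + (Di *v phi y - psi x)"
      by (simp add: matrix_vector_right_distrib matrix_vector_mult_diff_distrib
          matrix_vector_mul_assoc Di)
    then show ?thesis unfolding x_def by (simp add: algebra_simps)
  qed
  ultimately show ?thesis by blast
qed

lemma affine_diffeo_finv:
  assumes "Di ** D = mat 1"
  shows "affine_diffeo Sig A finv Di"
proof -
  have "continuous_on (- Sig) (inv_into (- Sig) finv)"
  proof (rule continuous_on_eq)
    show "continuous_on (- Sig) f"
      using affine_diffeo unfolding affine_diffeo_def by auto
    show "f x = inv_into (- Sig) finv x" if "x \<in> - Sig" for x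
      using that inv_into_inv_into_eq[OF bij_surface] by simp
  qed
  moreover have "\<forall>y \<in> - Sig. \<forall>(U, phi) \<in> A. \<forall>(V, psi) \<in> A. y \<in> U \<and> finv y \<in> V \<longrightarrow>
      (\<exists>W. open W \<and> y \<in> W \<and> W \<subseteq> U \<and> finv ` W \<subseteq> V \<and>
         (\<forall>y' \<in> W. psi (finv y') = Di *v phi y' + (psi (finv y) - Di *v phi y)))"
    by clarify (rule finv_affine_in_charts[OF assms], simp_all)
  ultimately show ?thesis
    unfolding affine_diffeo_def using bij_betw_inv_into[OF bij_surface] continuous_on_finv
    by (intro conjI)
qed

lemma chart_segment_image_locally_straight:
  assumes U: "(U, phi) \<in> A"
    and \<sigma>: "\<forall>\<tau> \<in> {0..1}. \<sigma> \<tau> \<in> U \<and> phi (\<sigma> \<tau>) = a + \<tau> *\<^sub>R b"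
    and \<tau>: "\<tau> \<in> {0..1}"
  shows "\<exists>B V psi c. open B \<and> \<tau> \<in> B \<and> (V, psi) \<in> A \<and>
    (\<forall>\<tau>' \<in> B \<inter> {0..1}. f (\<sigma> \<tau>') \<in> V \<and> psi (f (\<sigma> \<tau>')) = c + \<tau>' *\<^sub>R (D *v b))"
proof -
  have \<sigma>\<tau>: "\<sigma> \<tau> \<in> U" using \<sigma> \<tau> by blast
  then have "\<sigma> \<tau> \<in> - Sig" using chartD(2)[OF U] by blast
  then obtain V psi where V: "(V, psi) \<in> A" "f (\<sigma> \<tau>) \<in> V"
    using chart_cover[OF maps_surface] by blast
  let ?F = "inf (nhds \<tau>) (principal {0..1})"
  have "\<forall>\<^sub>F \<tau>' in ?F. \<sigma> \<tau>' \<in> U \<and> phi (\<sigma> \<tau>') = a + \<tau>' *\<^sub>R b"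
    unfolding eventually_inf_principal using \<sigma> by (simp add: always_eventually)
  moreover have "((\<lambda>\<tau>'. a + \<tau>' *\<^sub>R b) \<longlongrightarrow> a + \<tau> *\<^sub>R b) (nhds \<tau>)"
    by (intro tendsto_add tendsto_const tendsto_scaleR filterlim_ident)
  then have "((\<lambda>\<tau>'. a + \<tau>' *\<^sub>R b) \<longlongrightarrow> phi (\<sigma> \<tau>)) ?F"
    using \<sigma> \<tau> by (simp add: tendsto_mono[OF inf_le1])
  ultimately have "\<forall>\<^sub>F \<tau>' in ?F. \<sigma> \<tau>' \<in> - Sig \<and> f (\<sigma> \<tau>') \<in> V \<and>
      psi (f (\<sigma> \<tau>')) = D *v (a + \<tau>' *\<^sub>R b) + (psi (f (\<sigma> \<tau>)) - D *v phi (\<sigma> \<tau>))"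
    by (rule eventually_image_developed[OF U V(1) \<sigma>\<tau> V(2)])
  then obtain B where "open B" "\<tau> \<in> B" and B: "\<forall>\<tau>' \<in> B. \<tau>' \<in> {0..1} \<longrightarrow>
      \<sigma> \<tau>' \<in> - Sig \<and> f (\<sigma> \<tau>') \<in> V \<and>
      psi (f (\<sigma> \<tau>')) = D *v (a + \<tau>' *\<^sub>R b) + (psi (f (\<sigma> \<tau>)) - D *v phi (\<sigma> \<tau>))"
    unfolding eventually_inf_principal eventually_nhds by blast
  have "\<forall>\<tau>' \<in> B \<inter> {0..1}. f (\<sigma> \<tau>') \<in> V \<and>
      psi (f (\<sigma> \<tau>')) = (D *v a + (psi (f (\<sigma> \<tau>)) - D *v phi (\<sigma> \<tau>))) + \<tau>' *\<^sub>R (D *v b)"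
    using B by (simp add: matrix_vector_right_distrib matrix_vector_mult_scaleR algebra_simps)
  with \<open>open B\<close> \<open>\<tau> \<in> B\<close> V(1) show ?thesis by blast
qed

lemma chart_segment_image_chain:
  assumes U: "(U, phi) \<in> A" and pq: "p \<in> U" "q \<in> U"
    and seg: "closed_segment (phi p) (phi q) \<subseteq> phi ` U"
  shows "\<exists>ps cs. flat_chain A (f p) (f q) ps cs \<and> chain_length ps cs = norm (D *v (phi q - phi p))"
proof -
  define \<sigma> where "\<sigma> \<tau> = inv_into U phi (phi p + \<tau> *\<^sub>R (phi q - phi p))" for \<tau>
  have "closed_segment (phi p) (phi q) = (\<lambda>\<tau>. phi p + \<tau> *\<^sub>R (phi q - phi p)) ` {0..1}"
    using closed_segment_along_line[of 0 1 "phi p" "phi q - phi p"] by simp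
  with seg have "\<forall>\<tau> \<in> {0..1}. \<sigma> \<tau> \<in> U \<and> phi (\<sigma> \<tau>) = phi p + \<tau> *\<^sub>R (phi q - phi p)"
    unfolding \<sigma>_def by (auto simp: inv_into_into f_inv_into_f)
  then have "\<exists>ps cs. flat_chain A (f (\<sigma> 0)) (f (\<sigma> 1)) ps cs \<and>
      chain_length ps cs = norm (D *v (phi q - phi p))"
    by (intro flat_chain_along_locally_straight_path chart_segment_image_locally_straight[OF U])
  moreover have "\<sigma> 0 = p" "\<sigma> 1 = q"
    using pq chartD(3)[OF U] by (simp_all add: \<sigma>_def inv_into_f_f)
  ultimately show ?thesis by simp
qed

lemma flat_chain_image:
  assumes "flat_chain A x y ps cs"
  shows "\<exists>ps' cs'. flat_chain A (f x) (f y) ps' cs' \<and>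
           chain_length ps' cs' \<le> onorm ((*v) D) * chain_length ps cs"
  using assms
proof (induction cs arbitrary: x ps)
  case Nil
  then have "flat_chain A (f x) (f y) [f x] []" by (simp add: flat_chain_Nil)
  then show ?case by (intro exI[of _ "[f x]"] exI[of _ "[]"]) (simp add: chain_length_def)
next
  case (Cons c cs)
  from Cons.prems obtain p ps' where ps: "ps = x # p # ps'"
    and c: "c \<in> A" "x \<in> fst c" "p \<in> fst c" "closed_segment (snd c x) (snd c p) \<subseteq> snd c ` fst c"
    and tail: "flat_chain A p y (p # ps') cs"
    unfolding flat_chain_Cons by blast
  have "\<exists>qs ds. flat_chain A (f x) (f p) qs ds \<and>
      chain_length qs ds = norm (D *v (snd c p - snd c x))"
    using chart_segment_image_chain[of "fst c" "snd c" x p] c by simp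
  then obtain qs ds where head: "flat_chain A (f x) (f p) qs ds"
      "chain_length qs ds = norm (D *v (snd c p - snd c x))"
    by blast
  obtain qs' ds' where rest: "flat_chain A (f p) (f y) qs' ds'"
      "chain_length qs' ds' \<le> onorm ((*v) D) * chain_length (p # ps') cs"
    using Cons.IH[OF tail] by blast
  have "norm (D *v (snd c p - snd c x)) \<le> onorm ((*v) D) * norm (snd c p - snd c x)"
    by (rule onorm) simp
  with head(2) rest(2) have "chain_length qs ds + chain_length qs' ds' \<le>
      onorm ((*v) D) * chain_length ps (c # cs)"
    unfolding ps chain_length_Cons by (simp add: distrib_left add_mono)
  with flat_chain_append[OF head(1) rest(1)] show ?case
    by (intro exI[of _ "qs @ tl qs'"] exI[of _ "ds @ ds'"]) simp
qed

lemma lipschitz_on_surface: "lipschitz_on (max 1 (onorm ((*v) D))) (- Sig) f"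
proof (rule lipschitz_onI)
  let ?K = "max 1 (onorm ((*v) D))"
  define chains where "chains x y = {chain_length ps cs | ps cs. flat_chain A x y ps cs}" for x y
  fix x y assume x: "x \<in> - Sig" and y: "y \<in> - Sig"
  have dist_Inf: "dist x y = Inf (chains x y)" "dist (f x) (f y) = Inf (chains (f x) (f y))"
    using dist_flat x y maps_surface unfolding chains_def by auto
  show "dist (f x) (f y) \<le> ?K * dist x y"
  proof (cases "chains x y = {}")
    case False
    have "Inf (chains (f x) (f y)) \<le> ?K * Inf (chains x y)"
    proof (rule Inf_le_mult_Inf[OF False])
      show "bdd_below (chains (f x) (f y))"
        unfolding chains_def by (rule bdd_belowI[of _ 0]) (auto simp: chain_length_nonneg)
      fix l assume "l \<in> chains x y"
      then obtain ps cs where l: "l = chain_length ps cs" "flat_chain A x y ps cs"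
        unfolding chains_def by blast
      then obtain ps' cs' where "flat_chain A (f x) (f y) ps' cs'"
          and le: "chain_length ps' cs' \<le> onorm ((*v) D) * l"
        using flat_chain_image by blast
      then have "chain_length ps' cs' \<in> chains (f x) (f y)" unfolding chains_def by blast
      moreover have "onorm ((*v) D) * l \<le> ?K * l"
        using chain_length_nonneg l(1) by (intro mult_right_mono) auto
      ultimately show "\<exists>t \<in> chains (f x) (f y). t \<le> ?K * l"
        using le order_trans by blast
    qed simp
    with dist_Inf show ?thesis by simp
  next
    case True
    \<comment> \<open>By the inverse map, no flat chain joins \<open>f x\<close> to \<open>f y\<close> either: both distances are
      the same unspecified value \<open>Inf {}\<close>.\<close>
    obtain Di where "Di ** D = mat 1" using derivative_left_invertible by blast
    then interpret inv: affine_diffeomorphism Sig A finv Di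
      by unfold_locales (rule affine_diffeo_finv)
    have "chains (f x) (f y) = {}"
    proof (rule ccontr)
      assume "chains (f x) (f y) \<noteq> {}"
      then obtain ps cs where "flat_chain A (f x) (f y) ps cs" unfolding chains_def by blast
      from inv.flat_chain_image[OF this] obtain ps' cs' where "flat_chain A x y ps' cs'"
        using x y finv_f by auto
      with True show False unfolding chains_def by blast
    qed
    with True dist_Inf have "dist (f x) (f y) = dist x y" by simp
    then show ?thesis by (simp add: mult_le_cancel_right1)
  qed
qed simp

lemma homeomorphic_extension:
  obtains G H where "continuous_on UNIV G" "continuous_on UNIV H"
    "\<And>x. x \<in> - Sig \<Longrightarrow> G x = f x" "\<And>x. H (G x) = x" "\<And>y. G (H y) = y"
    "\<And>x. G x \<in> Sig \<longleftrightarrow> x \<in> Sig"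
proof -
  obtain G where G: "continuous_on UNIV G" "\<And>x. x \<in> - Sig \<Longrightarrow> G x = f x"
    using lipschitz_extension_to_completion[OF complete_UNIV dense_surface lipschitz_on_surface]
    by blast
  obtain Di where "Di ** D = mat 1" using derivative_left_invertible by blast
  then interpret inv: affine_diffeomorphism Sig A finv Di
    by unfold_locales (rule affine_diffeo_finv)
  obtain H where H: "continuous_on UNIV H" "\<And>x. x \<in> - Sig \<Longrightarrow> H x = finv x"
    using lipschitz_extension_to_completion[OF complete_UNIV dense_surface inv.lipschitz_on_surface]
    by blast
  have HG: "H (G x) = x" for x
  proof (rule continuous_eq_on_dense[OF dense_surface, of "\<lambda>x. H (G x)" "\<lambda>x. x"])
    show "continuous_on UNIV (\<lambda>x. H (G x))"
      by (rule continuous_on_compose2[OF H(1) G(1)]) simp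
    show "H (G x) = x" if "x \<in> - Sig" for x
      using that G(2) H(2) maps_surface finv_f by simp
  qed (rule continuous_on_id)
  have GH: "G (H y) = y" for y
  proof (rule continuous_eq_on_dense[OF dense_surface, of "\<lambda>y. G (H y)" "\<lambda>y. y"])
    show "continuous_on UNIV (\<lambda>y. G (H y))"
      by (rule continuous_on_compose2[OF G(1) H(1)]) simp
    show "G (H y) = y" if "y \<in> - Sig" for y
      using that G(2) H(2) finv_maps_surface f_finv by simp
  qed (rule continuous_on_id)
  have "G x \<in> Sig \<longleftrightarrow> x \<in> Sig" for x
  proof
    assume "G x \<in> Sig"
    then show "x \<in> Sig" using G(2) maps_surface by force
  next
    assume "x \<in> Sig"
    then have "H (G x) \<notin> - Sig" using HG by simp
    then show "G x \<in> Sig" using H(2) finv_maps_surface by force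
  qed
  with G(1) H(1) G(2) HG GH that show ?thesis by blast
qed

end

section \<open>Transport of saddle connections and cylinders\<close>

locale affine_homeo_extension = affine_diffeomorphism +
  fixes G H :: "'a \<Rightarrow> 'a"
  assumes continuous_G: "continuous_on UNIV G" and continuous_H: "continuous_on UNIV H"
    and G_extends: "\<And>x. x \<in> - Sig \<Longrightarrow> G x = f x"
    and H_G: "\<And>x. H (G x) = x" and G_H: "\<And>y. G (H y) = y"
    and G_singularities: "\<And>x. G x \<in> Sig \<longleftrightarrow> x \<in> Sig"
begin

lemma homeomorphic_map_G: "homeomorphic_map euclidean euclidean G"
  unfolding homeomorphic_map_maps homeomorphic_maps_def
  using continuous_G continuous_H H_G G_H by auto

lemma inj_G: "inj G"
  by (metis H_G injI)

lemma surj_G: "surj G"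
  by (metis G_H surjI)

lemma closure_image_G: "closure (G ` S) = G ` closure S"
  using homeomorphic_map_closure_of[OF homeomorphic_map_G, of S] by simp

lemma interior_image_G: "interior (G ` S) = G ` interior S"
  using homeomorphic_map_interior_of[OF homeomorphic_map_G, of S] by simp

lemma frontier_image_G: "frontier (G ` S) = G ` frontier S"
  using homeomorphic_map_frontier_of[OF homeomorphic_map_G, of S] by simp

lemma eventually_image_developed_G:
  assumes U0: "(U0, phi0) \<in> A" and U: "(U, phi) \<in> A" and p: "p \<in> U0" "G p \<in> U"
    and develops: "\<forall>\<^sub>F s in F. \<Phi> s \<in> U0 \<and> phi0 (\<Phi> s) = L s"
    and lim: "(L \<longlongrightarrow> phi0 p) F"
  shows "\<forall>\<^sub>F s in F. G (\<Phi> s) \<in> U \<and> phi (G (\<Phi> s)) = D *v L s + (phi (G p) - D *v phi0 p)"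
proof -
  have "G p = f p" using p(1) chartD(2)[OF U0] G_extends by blast
  with eventually_image_developed[OF U0 U p(1) _ develops lim] p(2) show ?thesis
    by (auto elim: eventually_mono simp: G_extends)
qed

lemma saddle_connection_image:
  assumes "saddle_connection Sig A \<gamma> v"
  shows "saddle_connection Sig A (G \<circ> \<gamma>) (D *v v)"
proof -
  have \<gamma>: "v \<noteq> 0" "continuous_on {0..1} \<gamma>" "\<gamma> 0 \<in> Sig" "\<gamma> 1 \<in> Sig" "\<gamma> ` {0<..<1} \<subseteq> - Sig"
    using assms unfolding saddle_connection_def by auto
  have straight: "\<forall>t \<in> {0<..<1}. \<forall>(U, phi) \<in> A. \<gamma> t \<in> U \<longrightarrow>
      (\<exists>e>0. \<forall>s. \<bar>s - t\<bar> < e \<longrightarrow> \<gamma> s \<in> U \<and> phi (\<gamma> s) = phi (\<gamma> t) + (s - t) *\<^sub>R v)"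
    using assms unfolding saddle_connection_def by (elim conjE) assumption
  have straight_image: "\<exists>e>0. \<forall>s. \<bar>s - t\<bar> < e \<longrightarrow>
      (G \<circ> \<gamma>) s \<in> U \<and> phi ((G \<circ> \<gamma>) s) = phi ((G \<circ> \<gamma>) t) + (s - t) *\<^sub>R (D *v v)"
    if t: "t \<in> {0<..<1}" and U: "(U, phi) \<in> A" "G (\<gamma> t) \<in> U" for t U phi
  proof -
    have "\<gamma> t \<in> - Sig" using \<gamma>(5) t by blast
    then obtain U0 phi0 where U0: "(U0, phi0) \<in> A" "\<gamma> t \<in> U0" by (rule chart_cover)
    define L where "L s = phi0 (\<gamma> t) + (s - t) *\<^sub>R v" for s
    have "\<exists>e>0. \<forall>s. \<bar>s - t\<bar> < e \<longrightarrow> \<gamma> s \<in> U0 \<and> phi0 (\<gamma> s) = L s"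
      using bspec[OF bspec[OF straight t] U0(1)] U0(2) unfolding L_def by simp
    then have "\<forall>\<^sub>F s in nhds t. \<gamma> s \<in> U0 \<and> phi0 (\<gamma> s) = L s"
      unfolding eventually_nhds_real_iff .
    moreover have "isCont L t" unfolding L_def by (intro continuous_intros)
    then have "(L \<longlongrightarrow> L t) (nhds t)"
      by (simp add: isCont_def tendsto_at_iff_tendsto_nhds)
    then have "(L \<longlongrightarrow> phi0 (\<gamma> t)) (nhds t)"
      by (simp add: L_def)
    ultimately have "\<forall>\<^sub>F s in nhds t. G (\<gamma> s) \<in> U \<and>
        phi (G (\<gamma> s)) = D *v L s + (phi (G (\<gamma> t)) - D *v phi0 (\<gamma> t))"
      by (rule eventually_image_developed_G[OF U0(1) U(1) U0(2) U(2)])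
    then show ?thesis
      unfolding eventually_nhds_real_iff
      by (simp add: L_def matrix_vector_right_distrib matrix_vector_mult_scaleR add.commute)
  qed
  have "\<forall>t \<in> {0<..<1}. \<forall>(U, phi) \<in> A. (G \<circ> \<gamma>) t \<in> U \<longrightarrow>
      (\<exists>e>0. \<forall>s. \<bar>s - t\<bar> < e \<longrightarrow>
         (G \<circ> \<gamma>) s \<in> U \<and> phi ((G \<circ> \<gamma>) s) = phi ((G \<circ> \<gamma>) t) + (s - t) *\<^sub>R (D *v v))"
    by clarify (rule straight_image, simp_all)
  moreover have "D *v v \<noteq> 0" using \<gamma>(1) derivative_injective by blast
  moreover have "continuous_on {0..1} (G \<circ> \<gamma>)"
    using \<gamma>(2) continuous_on_subset[OF continuous_G] by (rule continuous_on_compose) simp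
  moreover have "(G \<circ> \<gamma>) 0 \<in> Sig" "(G \<circ> \<gamma>) 1 \<in> Sig" "(G \<circ> \<gamma>) ` {0<..<1} \<subseteq> - Sig"
    using \<gamma>(3-5) G_singularities by auto
  ultimately show ?thesis
    unfolding saddle_connection_def by (intro conjI)
qed

lemma strip_image_developed:
  assumes "F s t \<in> - Sig"
    and straight: "\<forall>(U, phi) \<in> A. F s t \<in> U \<longrightarrow> (\<exists>e>0. \<exists>k. \<forall>s' t'.
      \<bar>s' - s\<bar> < e \<and> \<bar>t' - t\<bar> < e \<longrightarrow> F s' t' \<in> U \<and> phi (F s' t') = s' *\<^sub>R c + t' *\<^sub>R w + k)"
    and U: "(U, phi) \<in> A" "G (F s t) \<in> U"
  shows "\<exists>e>0. \<exists>k. \<forall>s' t'. \<bar>s' - s\<bar> < e \<and> \<bar>t' - t\<bar> < e \<longrightarrow>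
    G (F s' t') \<in> U \<and> phi (G (F s' t')) = s' *\<^sub>R (D *v c) + t' *\<^sub>R (D *v w) + k"
proof -
  obtain U0 phi0 where U0: "(U0, phi0) \<in> A" "F s t \<in> U0"
    using chart_cover[OF assms(1)] by blast
  from bspec[OF straight U0(1)] U0(2) obtain e k where "e > 0"
    and box: "\<forall>s' t'. \<bar>s' - s\<bar> < e \<and> \<bar>t' - t\<bar> < e \<longrightarrow>
      F s' t' \<in> U0 \<and> phi0 (F s' t') = s' *\<^sub>R c + t' *\<^sub>R w + k"
    by auto
  define L where "L z = fst z *\<^sub>R c + snd z *\<^sub>R w + k" for z :: "real \<times> real"
  have developed: "\<forall>\<^sub>F z in nhds (s, t). case_prod F z \<in> U0 \<and> phi0 (case_prod F z) = L z"
    unfolding eventually_nhds_real_pair_iff using \<open>e > 0\<close> box by (auto simp: L_def)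
  have "isCont L (s, t)" unfolding L_def by (intro continuous_intros)
  then have "(L \<longlongrightarrow> L (s, t)) (nhds (s, t))"
    by (simp add: isCont_def tendsto_at_iff_tendsto_nhds)
  moreover have "L (s, t) = phi0 (F s t)"
    using box \<open>e > 0\<close> by (simp add: L_def)
  ultimately have "(L \<longlongrightarrow> phi0 (F s t)) (nhds (s, t))" by simp
  with developed have "\<forall>\<^sub>F z in nhds (s, t). G (case_prod F z) \<in> U \<and>
      phi (G (case_prod F z)) = D *v L z + (phi (G (F s t)) - D *v phi0 (F s t))"
    using eventually_image_developed_G[OF U0(1) U(1) U0(2)] U(2) by blast
  then obtain e' where "e' > 0" and box': "\<forall>s' t'. \<bar>s' - s\<bar> < e' \<and> \<bar>t' - t\<bar> < e' \<longrightarrow>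
      G (F s' t') \<in> U \<and> phi (G (F s' t')) = D *v L (s', t') + (phi (G (F s t)) - D *v phi0 (F s t))"
    unfolding eventually_nhds_real_pair_iff by auto
  show ?thesis
  proof (intro exI conjI allI impI)
    fix s' t' assume "\<bar>s' - s\<bar> < e' \<and> \<bar>t' - t\<bar> < e'"
    with box' show "G (F s' t') \<in> U"
      and "phi (G (F s' t')) = s' *\<^sub>R (D *v c) + t' *\<^sub>R (D *v w) +
        (D *v k + (phi (G (F s t)) - D *v phi0 (F s t)))"
      by (simp_all add: L_def matrix_vector_right_distrib matrix_vector_mult_scaleR)
  qed (fact \<open>e' > 0\<close>)
qed

lemma frontier_saddle_connections_image:
  assumes "frontier C =
    \<Union>{\<gamma> ` {0..1} | \<gamma> v. saddle_connection Sig A \<gamma> v \<and> \<gamma> ` {0..1} \<subseteq> frontier C}"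
  shows "frontier (G ` C) =
    \<Union>{\<gamma> ` {0..1} | \<gamma> v. saddle_connection Sig A \<gamma> v \<and> \<gamma> ` {0..1} \<subseteq> frontier (G ` C)}"
proof
  show "frontier (G ` C) \<subseteq>
      \<Union>{\<gamma> ` {0..1} | \<gamma> v. saddle_connection Sig A \<gamma> v \<and> \<gamma> ` {0..1} \<subseteq> frontier (G ` C)}"
  proof
    fix y assume "y \<in> frontier (G ` C)"
    then obtain x where x: "x \<in> frontier C" "y = G x" unfolding frontier_image_G by blast
    then obtain \<gamma> v where \<gamma>: "saddle_connection Sig A \<gamma> v" "\<gamma> ` {0..1} \<subseteq> frontier C"
        "x \<in> \<gamma> ` {0..1}"
      using assms by blast
    have "saddle_connection Sig A (G \<circ> \<gamma>) (D *v v)"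
      using saddle_connection_image[OF \<gamma>(1)] .
    moreover have "(G \<circ> \<gamma>) ` {0..1} \<subseteq> frontier (G ` C)"
      using \<gamma>(2) unfolding frontier_image_G image_comp[symmetric] by blast
    moreover have "y \<in> (G \<circ> \<gamma>) ` {0..1}" using \<gamma>(3) x(2) by auto
    ultimately show "y \<in> \<Union>{\<gamma> ` {0..1} | \<gamma> v. saddle_connection Sig A \<gamma> v \<and>
        \<gamma> ` {0..1} \<subseteq> frontier (G ` C)}"
      by blast
  qed
qed blast

lemma cylinder_image:
  assumes "cylinder Sig A C c"
  shows "cylinder Sig A (G ` C) (D *v c)"
proof -
  have C: "closed C" "C = closure (interior C)"
    and frontier_C: "frontier C = \<Union>{\<gamma> ` {0..1} | \<gamma> v. saddle_connection Sig A \<gamma> v \<and> \<gamma> ` {0..1} \<subseteq> frontier C}"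
    using assms unfolding cylinder_def by auto
  obtain w F where wF: "independent {c, w}" "c \<noteq> w"
        "interior C = {F s t | s t. 0 < t \<and> t < 1}"
        "\<forall>s t. 0 < t \<and> t < 1 \<longrightarrow> F s t \<in> - Sig \<and> F (s + 1) t = F s t"
        "\<forall>s t s' t'. 0 < t \<and> t < 1 \<and> 0 < t' \<and> t' < 1 \<and> F s t = F s' t' \<longrightarrow>
            t = t' \<and> s - s' \<in> \<int>"
    and straight: "\<forall>s t. 0 < t \<and> t < 1 \<longrightarrow> (\<forall>(U, phi) \<in> A. F s t \<in> U \<longrightarrow>
            (\<exists>e>0. \<exists>k. \<forall>s' t'. \<bar>s' - s\<bar> < e \<and> \<bar>t' - t\<bar> < e \<longrightarrow>
               F s' t' \<in> U \<and> phi (F s' t') = s' *\<^sub>R c + t' *\<^sub>R w + k))"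
    using assms unfolding cylinder_def by (elim conjE exE) blast
  define F' where "F' s t = G (F s t)" for s t
  have "independent {D *v c, D *v w}"
    using linear_independent_injective_image[OF matrix_vector_mul_linear wF(1)
        inj_on_subset[OF inj_derivative subset_UNIV]]
    by simp
  moreover have "D *v c \<noteq> D *v w" using wF(2) inj_derivative by (auto dest: injD)
  moreover have "interior (G ` C) = {F' s t | s t. 0 < t \<and> t < 1}"
    unfolding interior_image_G wF(3) F'_def by blast
  moreover have "\<forall>s t. 0 < t \<and> t < 1 \<longrightarrow> F' s t \<in> - Sig \<and> F' (s + 1) t = F' s t"
    using wF(4) G_singularities unfolding F'_def by auto
  moreover have "\<forall>s t s' t'. 0 < t \<and> t < 1 \<and> 0 < t' \<and> t' < 1 \<and> F' s t = F' s' t' \<longrightarrow>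
      t = t' \<and> s - s' \<in> \<int>"
    using wF(5) inj_G unfolding F'_def by (auto dest: injD)
  moreover have "\<forall>s t. 0 < t \<and> t < 1 \<longrightarrow> (\<forall>(U, phi) \<in> A. F' s t \<in> U \<longrightarrow>
      (\<exists>e>0. \<exists>k. \<forall>s' t'. \<bar>s' - s\<bar> < e \<and> \<bar>t' - t\<bar> < e \<longrightarrow>
         F' s' t' \<in> U \<and> phi (F' s' t') = s' *\<^sub>R (D *v c) + t' *\<^sub>R (D *v w) + k))"
    unfolding F'_def
  proof clarify
    fix s t U phi assume "0 < t" "t < 1" "(U, phi) \<in> A" "G (F s t) \<in> U"
    with wF(4) straight show "\<exists>e>0. \<exists>k. \<forall>s' t'. \<bar>s' - s\<bar> < e \<and> \<bar>t' - t\<bar> < e \<longrightarrow>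
        G (F s' t') \<in> U \<and> phi (G (F s' t')) = s' *\<^sub>R (D *v c) + t' *\<^sub>R (D *v w) + k"
      by (intro strip_image_developed) blast+
  qed
  moreover have "closed (G ` C)"
    using closure_image_G[of C] C(1) by (metis closure_closed closed_closure)
  moreover have "G ` C = closure (interior (G ` C))"
    using C(2) by (simp add: interior_image_G closure_image_G)
  moreover note frontier_saddle_connections_image[OF frontier_C]
  ultimately show ?thesis
    unfolding cylinder_def by blast
qed

lemma cylinder_decomposition_image:
  assumes "cylinder_decomposition Sig A \<C> d"
  shows "cylinder_decomposition Sig A ((`) G ` \<C>) (D *v d)"
proof -
  have d: "d \<noteq> 0" "\<forall>C \<in> \<C>. \<exists>c. cylinder Sig A C c \<and> (\<exists>r::real. c = r *\<^sub>R d)"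
    "\<forall>C \<in> \<C>. \<forall>C' \<in> \<C>. C \<noteq> C' \<longrightarrow> C \<inter> C' \<subseteq> frontier C \<inter> frontier C'"
    "closure (\<Union>\<C>) = UNIV"
    using assms unfolding cylinder_decomposition_def by auto
  have "D *v d \<noteq> 0" using d(1) derivative_injective by blast
  moreover have "\<forall>C' \<in> (`) G ` \<C>. \<exists>c. cylinder Sig A C' c \<and> (\<exists>r::real. c = r *\<^sub>R (D *v d))"
  proof
    fix C' assume "C' \<in> (`) G ` \<C>"
    then obtain C where C: "C \<in> \<C>" "C' = G ` C" by blast
    then obtain c r where c: "cylinder Sig A C c" "c = r *\<^sub>R d" using d(2) by blast
    have "cylinder Sig A C' (D *v c)" using cylinder_image[OF c(1)] C(2) by simp
    moreover have "D *v c = r *\<^sub>R (D *v d)" using c(2) by (simp add: matrix_vector_mult_scaleR)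
    ultimately show "\<exists>c. cylinder Sig A C' c \<and> (\<exists>r::real. c = r *\<^sub>R (D *v d))" by blast
  qed
  moreover have "\<forall>C1 \<in> (`) G ` \<C>. \<forall>C2 \<in> (`) G ` \<C>. C1 \<noteq> C2 \<longrightarrow>
      C1 \<inter> C2 \<subseteq> frontier C1 \<inter> frontier C2"
  proof (intro ballI impI)
    fix C1 C2 assume "C1 \<in> (`) G ` \<C>" "C2 \<in> (`) G ` \<C>" "C1 \<noteq> C2"
    then obtain B1 B2 where B: "B1 \<in> \<C>" "B2 \<in> \<C>" "C1 = G ` B1" "C2 = G ` B2" "B1 \<noteq> B2"
      by blast
    then have "B1 \<inter> B2 \<subseteq> frontier B1 \<inter> frontier B2" using d(3) by blast
    then show "C1 \<inter> C2 \<subseteq> frontier C1 \<inter> frontier C2"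
      unfolding B(3,4) frontier_image_G image_Int[OF inj_G, symmetric] by (rule image_mono)
  qed
  moreover have "closure (\<Union>((`) G ` \<C>)) = UNIV"
  proof -
    have "\<Union>((`) G ` \<C>) = G ` \<Union>\<C>" by blast
    then show ?thesis using d(4) surj_G by (simp add: closure_image_G)
  qed
  ultimately show ?thesis
    unfolding cylinder_decomposition_def by (intro conjI)
qed

lemma rigid_spine_image:
  assumes "rigid_spine Sig A \<gamma> v"
  shows "rigid_spine Sig A (G \<circ> \<gamma>) (D *v v)"
proof -
  obtain \<C> d r where \<C>: "cylinder_decomposition Sig A \<C> d" "v = r *\<^sub>R d"
    "\<forall>C \<in> \<C>. \<not> \<gamma> ` {0..1} \<subseteq> C"
    using assms unfolding rigid_spine_def by blast
  have "cylinder_decomposition Sig A ((`) G ` \<C>) (D *v d)"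
    using cylinder_decomposition_image[OF \<C>(1)] .
  moreover have "D *v v = r *\<^sub>R (D *v d)"
    using \<C>(2) by (simp add: matrix_vector_mult_scaleR)
  moreover have "(G \<circ> \<gamma>) ` {0..1} \<subseteq> closure (\<Union>((`) G ` \<C>))"
    using calculation(1) unfolding cylinder_decomposition_def by simp
  moreover have "\<not> (G \<circ> \<gamma>) ` {0..1} \<subseteq> C'" if C': "C' \<in> (`) G ` \<C>" for C'
  proof -
    obtain C where "C \<in> \<C>" "C' = G ` C" using C' by blast
    then show ?thesis
      unfolding image_comp[symmetric] using \<C>(3) inj_image_subset_iff[OF inj_G] by simp
  qed
  moreover have "saddle_connection Sig A (G \<circ> \<gamma>) (D *v v)"
    using assms saddle_connection_image unfolding rigid_spine_def by blast
  ultimately show ?thesis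
    unfolding rigid_spine_def by blast
qed

end

lemma rigid_spine_holonomies_image:
  assumes "translation_surface Sig A" "D \<in> veech_group Sig A" "v \<in> rigid_spine_holonomies Sig A"
  shows "D *v v \<in> rigid_spine_holonomies Sig A"
proof -
  obtain f where "affine_diffeo Sig A f D" using assms(2) unfolding veech_group_def by blast
  with assms(1) interpret affine_diffeomorphism Sig A f D
    by unfold_locales
  obtain G H where "continuous_on UNIV G" "continuous_on UNIV H"
    "\<And>x. x \<in> - Sig \<Longrightarrow> G x = f x" "\<And>x. H (G x) = x" "\<And>y. G (H y) = y"
    "\<And>x. G x \<in> Sig \<longleftrightarrow> x \<in> Sig"
    using homeomorphic_extension by blast
  then interpret affine_homeo_extension Sig A f D G H
    by unfold_locales
  obtain \<gamma> where "rigid_spine Sig A \<gamma> v"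
    using assms(3) unfolding rigid_spine_holonomies_def by blast
  then show ?thesis
    using rigid_spine_image unfolding rigid_spine_holonomies_def by blast
qed

section \<open>Discreteness of the Veech group\<close>

lemma tendsto_matrix_vector_mult_left:
  fixes b :: "real^'n"
  shows "((\<lambda>M::real^'n^'m. M *v b) \<longlongrightarrow> D *v b) (nhds D)"
proof -
  have "linear (\<lambda>M::real^'n^'m. M *v b)"
    by (rule linearI) (simp_all add: matrix_vector_mult_add_rdistrib scaleR_matrix_vector_assoc)
  then have "bounded_linear (\<lambda>M::real^'n^'m. M *v b)"
    by (simp add: linear_conv_bounded_linear)
  from bounded_linear.tendsto[OF this filterlim_ident] show ?thesis .
qed

lemma discrete_subset_if_spanning_set_maps_into_discrete:
  fixes \<Gamma> :: "(real^'n^'m) set" and B :: "(real^'n) set" and R :: "(real^'m) set"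
  assumes "discrete_set R" "finite B" "span B = UNIV"
    and "\<And>M b. M \<in> \<Gamma> \<Longrightarrow> b \<in> B \<Longrightarrow> M *v b \<in> R"
  shows "discrete_subset \<Gamma>"
  unfolding discrete_subset_def
proof
  fix M assume "M \<in> \<Gamma>"
  have "\<forall>\<^sub>F N in nhds M. N \<in> \<Gamma> \<longrightarrow> N *v b = M *v b" if b: "b \<in> B" for b
  proof -
    have "\<not> (M *v b) islimpt R" using assms(1) unfolding discrete_set_def by blast
    then obtain e where "e > 0" and isolated: "\<forall>z \<in> R. z \<noteq> M *v b \<longrightarrow> \<not> dist z (M *v b) < e"
      unfolding islimpt_approachable by blast
    from tendsto_matrix_vector_mult_left \<open>e > 0\<close>
    have "\<forall>\<^sub>F N in nhds M. dist (N *v b) (M *v b) < e"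
      by (rule tendstoD)
    then show ?thesis
    proof (rule eventually_mono)
      fix N assume "dist (N *v b) (M *v b) < e"
      with isolated assms(4)[OF _ b] show "N \<in> \<Gamma> \<longrightarrow> N *v b = M *v b" by blast
    qed
  qed
  then have "\<forall>\<^sub>F N in nhds M. \<forall>b \<in> B. N \<in> \<Gamma> \<longrightarrow> N *v b = M *v b"
    using assms(2) by (intro eventually_ball_finite) auto
  then have "\<forall>\<^sub>F N in nhds M. N \<in> \<Gamma> \<longrightarrow> N = M"
  proof (rule eventually_mono, intro impI)
    fix N assume "\<forall>b \<in> B. N \<in> \<Gamma> \<longrightarrow> N *v b = M *v b" "N \<in> \<Gamma>"
    then have "N *v x = M *v x" for x
      using linear_eq_on_span[OF matrix_vector_mul_linear matrix_vector_mul_linear, of B N M x] assms(3)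
      by auto
    then show "N = M" by (simp add: matrix_eq)
  qed
  then show "\<exists>e>0. \<forall>N \<in> \<Gamma>. dist N M < e \<longrightarrow> N = M"
    unfolding eventually_nhds_metric by blast
qed

lemma span_pair_eq_UNIV:
  fixes u v :: "real^2"
  assumes "independent {u, v}" "u \<noteq> v"
  shows "span {u, v} = UNIV"
proof -
  have "(UNIV :: (real^2) set) \<subseteq> span {u, v}"
    by (rule card_ge_dim_independent) (use assms in auto)
  then show ?thesis by auto
qed

theorem theorem1p2:
  fixes Sig :: "'a::metric_space set" and A :: "'a chart set"
  assumes "translation_surface Sig A"
    and "discrete_set (rigid_spine_holonomies Sig A)"
    and "\<exists>u \<in> rigid_spine_holonomies Sig A. \<exists>v \<in> rigid_spine_holonomies Sig A.
           u \<noteq> v \<and> independent {u, v}"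
  shows "discrete_subset (veech_group Sig A)"
proof -
  from assms(3) obtain u v
    where uv: "u \<in> rigid_spine_holonomies Sig A" "v \<in> rigid_spine_holonomies Sig A"
      "u \<noteq> v" "independent {u, v}"
    by blast
  show ?thesis
  proof (rule discrete_subset_if_spanning_set_maps_into_discrete[where B = "{u, v}", OF assms(2)])
    show "span {u, v} = UNIV" using span_pair_eq_UNIV[OF uv(4,3)] .
    fix D b assume "D \<in> veech_group Sig A" "b \<in> {u, v}"
    with uv(1,2) show "D *v b \<in> rigid_spine_holonomies Sig A"
      using rigid_spine_holonomies_image[OF assms(1)] by blast
  qed simp
qed

end
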